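(* For every pair of positive integers $s$ and $t$ with $t \ge \max\{2, s\}$, there is a constant $C = C(s,t)$ such that, if $n$ is large enough, then every $2$-edge-coloring $E(K_n) = E(R) \cup E(B)$ with $\min\{e(R), e(B)\} \ge C n^{2-\frac{1}{s}}$ contains an induced monochromatic member of $\{K_{s,BR(t)}, S_{t,t}\}$; in particular, it contains an induced monochromatic member of $\mathcal{F}_{s,t} = \{K_{s,t}, S_{t,t}\}$.
   Context: A $2$-edge-coloring of $K_n$ is a partition $E(K_n) = E(R)\cup E(B)$ into red and blue edges; $R$ and $B$ are the graphs formed by the red and blue edges, and $e(R), e(B)$ are their numbers of edges. For $U \subseteq V(K_n)$, $R[U]$ (resp. $B[U]$) is the graph on $U$ formed by the red (resp. blue) edges with both ends in $U$. The coloring contains an induced monochromatic copy of a graph $H$ if there is $U\subseteq V(K_n)$ with $|U| = |V(H)|$ and $R[U]\cong H$ or $B[U]\cong H$. $K_{s,t}$ is the complete bipartite graph with parts of sizes $s$ and $t$. $S_{s,t}$ is the complete split graph: a clique on $s$ vertices, an independent set on $t$ vertices, and all $st$ edges between them. $BR(t)$ is the bipartite Ramsey number: the smallest integer such that every $2$-edge-coloring of $K_{m,m}$ with $m \ge BR(t)$ contains a monochromatic $K_{t,t}$. *)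

theory Defs
  imports Complex_Main
begin

text \<open>Finite simple graphs: every edge is a two-element set of vertices. All graphs
  constructed below satisfy this.\<close>

record 'a sgraph =
  verts :: "'a set"
  edges :: "'a set set"

definition sgraph_iso :: "'a sgraph \<Rightarrow> 'b sgraph \<Rightarrow> bool" where
  "sgraph_iso G H \<longleftrightarrow>
     (\<exists>f. bij_betw f (verts G) (verts H) \<and>
          (\<forall>u\<in>verts G. \<forall>v\<in>verts G. {u, v} \<in> edges G \<longleftrightarrow> {f u, f v} \<in> edges H))"

text \<open>\<open>G\<close> has a (not necessarily induced) subgraph isomorphic to \<open>H\<close>.\<close>

definition has_copy :: "'a sgraph \<Rightarrow> 'b sgraph \<Rightarrow> bool" where
  "has_copy G H \<longleftrightarrow>
     (\<exists>f. inj_on f (verts H) \<and> f ` verts H \<subseteq> verts G \<and> (\<forall>e\<in>edges H. f ` e \<in> edges G))"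

definition induced :: "'a sgraph \<Rightarrow> 'a set \<Rightarrow> 'a sgraph" where
  "induced G U = \<lparr>verts = U, edges = {e \<in> edges G. e \<subseteq> U}\<rparr>"

definition complete_graph :: "nat \<Rightarrow> nat sgraph" where
  "complete_graph n =
     \<lparr>verts = {..<n}, edges = {{i, j} | i j. i < n \<and> j < n \<and> i \<noteq> j}\<rparr>"

definition complete_bipartite :: "nat \<Rightarrow> nat \<Rightarrow> (nat + nat) sgraph" where
  "complete_bipartite s t =
     \<lparr>verts = {..<s} <+> {..<t}, edges = {{Inl i, Inr j} | i j. i < s \<and> j < t}\<rparr>"

text \<open>The left summand carries the clique, the right one the independent set.\<close>

definition complete_split :: "nat \<Rightarrow> nat \<Rightarrow> (nat + nat) sgraph" where
  "complete_split s t =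
     \<lparr>verts = {..<s} <+> {..<t},
      edges = {{Inl i, Inl j} | i j. i < s \<and> j < s \<and> i \<noteq> j}
            \<union> {{Inl i, Inr j} | i j. i < s \<and> j < t}\<rparr>"

text \<open>\<open>R\<close> and \<open>B\<close> are the sets of red and blue edges; either may be empty.\<close>

definition two_edge_coloring :: "'a sgraph \<Rightarrow> 'a set set \<Rightarrow> 'a set set \<Rightarrow> bool" where
  "two_edge_coloring G R B \<longleftrightarrow> edges G = R \<union> B \<and> R \<inter> B = {}"

definition color_graph :: "'a sgraph \<Rightarrow> 'a set set \<Rightarrow> 'a sgraph" where
  "color_graph G X = \<lparr>verts = verts G, edges = X\<rparr>"

definition has_mono_copy ::
    "'a sgraph \<Rightarrow> 'a set set \<Rightarrow> 'a set set \<Rightarrow> 'b sgraph \<Rightarrow> bool" where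
  "has_mono_copy G R B H \<longleftrightarrow> has_copy (color_graph G R) H \<or> has_copy (color_graph G B) H"

definition has_induced_mono_copy ::
    "'a sgraph \<Rightarrow> 'a set set \<Rightarrow> 'a set set \<Rightarrow> 'b sgraph \<Rightarrow> bool" where
  "has_induced_mono_copy G R B H \<longleftrightarrow>
     (\<exists>U \<subseteq> verts G. card U = card (verts H) \<and>
        (sgraph_iso (induced (color_graph G R) U) H \<or>
         sgraph_iso (induced (color_graph G B) U) H))"

definition has_induced_mono_member ::
    "'a sgraph \<Rightarrow> 'a set set \<Rightarrow> 'a set set \<Rightarrow> 'b sgraph set \<Rightarrow> bool" where
  "has_induced_mono_member G R B \<H> \<longleftrightarrow> (\<exists>H\<in>\<H>. has_induced_mono_copy G R B H)"

definition bipartite_ramsey :: "nat \<Rightarrow> nat" where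
  "bipartite_ramsey t =
     (LEAST m0. \<forall>m\<ge>m0. \<forall>R B. two_edge_coloring (complete_bipartite m m) R B \<longrightarrow>
        has_mono_copy (complete_bipartite m m) R B (complete_bipartite t t))"

definition unavoidable_family :: "nat \<Rightarrow> nat \<Rightarrow> (nat + nat) sgraph set" where
  "unavoidable_family s t = {complete_bipartite s t, complete_split t t}"

end

theory Submission
  imports Defs "HOL-Library.Ramsey"
begin

text \<open>If a large red clique and a large blue clique both exist, they share at most one vertex, and
  a pigeonhole argument on the edges between them yields an induced \<open>S\<^sub>t\<^sub>,\<^sub>t\<close>. Otherwise
  some colour, say red, has no large clique, so by Ramsey's theorem a positive proportion of the
  \<open>s\<close>-subsets of every large red neighbourhood are blue cliques. The double count of
  Kovari, Sos and Turan, restricted to blue \<open>s\<close>-cliques, then gives a blue \<open>s\<close>-clique with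
  many common red neighbours, among which Ramsey's theorem finds a blue clique of any prescribed
  size.\<close>

section \<open>Homogeneous bipartite pairs and supersaturation of independent sets\<close>

text \<open>Fix \<open>2 * t\<close> vertices \<open>A'\<close> of \<open>A\<close>. Each
  \<open>y\<close> in \<open>B\<close> traces a subset \<open>f y\<close> of \<open>A'\<close>, and
  there are \<open>2 ^ (2 * t)\<close> possible traces, so some \<open>Q\<close> is the trace of at
  least \<open>t\<close> elements of \<open>B\<close>. Either \<open>Q\<close> or its complement in
  \<open>A'\<close> has at least \<open>t\<close> elements.\<close>

lemma bipartite_mono_pair:
  fixes P :: "'a \<Rightarrow> 'b \<Rightarrow> bool"
  assumes "finite A" "2 * t \<le> card A" "finite B" "t * 2 ^ (2 * t) \<le> card B"
  obtains X Y where "X \<subseteq> A" "Y \<subseteq> B" "card X = t" "card Y = t"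
    "(\<forall>x\<in>X. \<forall>y\<in>Y. P x y) \<or> (\<forall>x\<in>X. \<forall>y\<in>Y. \<not> P x y)"
proof -
  obtain A' where A': "A' \<subseteq> A" "card A' = 2 * t" "finite A'"
    using assms obtain_subset_with_card_n by metis
  define f where "f y = {x \<in> A'. P x y}" for y
  have "f \<in> B \<rightarrow> Pow A'"
    by (auto simp: f_def)
  then have "\<exists>Q\<in>Pow A'. card B \<le> card (f -` {Q} \<inter> B) * card (Pow A')"
    using assms A' by (intro pigeonhole_card) auto
  then obtain Q where Q: "Q \<subseteq> A'" "card B \<le> card (f -` {Q} \<inter> B) * 2 ^ (2 * t)"
    using A' by (auto simp: card_Pow)
  have "t * 2 ^ (2 * t) \<le> card (f -` {Q} \<inter> B) * 2 ^ (2 * t)"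
    using assms Q by linarith
  then have "t \<le> card (f -` {Q} \<inter> B)"
    by simp
  then obtain Y where Y: "Y \<subseteq> f -` {Q} \<inter> B" "card Y = t"
    using obtain_subset_with_card_n by metis
  have Q_iff: "x \<in> Q \<longleftrightarrow> P x y" if "x \<in> A'" "y \<in> Y" for x y
  proof -
    have "f y = Q"
      using Y that by blast
    then show ?thesis
      using that by (auto simp: f_def)
  qed
  have "card Q + card (A' - Q) = 2 * t"
    using A' Q by (metis card_Diff_subset card_mono finite_subset le_add_diff_inverse)
  then consider "t \<le> card Q" | "t \<le> card (A' - Q)"
    by linarith
  then show ?thesis
  proof cases
    case 1
    then obtain X where X: "X \<subseteq> Q" "card X = t"
      using obtain_subset_with_card_n by metis
    then have "\<forall>x\<in>X. \<forall>y\<in>Y. P x y"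
      using Q_iff Q(1) by blast
    then show ?thesis
      using X Y Q A' by (intro that[of X Y]) auto
  next
    case 2
    then obtain X where X: "X \<subseteq> A' - Q" "card X = t"
      using obtain_subset_with_card_n by metis
    then have "\<forall>x\<in>X. \<forall>y\<in>Y. \<not> P x y"
      using Q_iff Q(1) by blast
    then show ?thesis
      using X Y Q A' by (intro that[of X Y]) auto
  qed
qed

text \<open>Double count of pairs \<open>S \<subseteq> Q\<close>: every \<open>r\<close>-set
  \<open>Q\<close> in \<open>D\<close> contributes at least one independent \<open>s\<close>-set
  \<open>S\<close>, and deleting \<open>S\<close> shows that each \<open>S\<close> lies in at most
  \<open>(card D - s) choose (r - s)\<close> such \<open>Q\<close>. In the application
  \<open>r\<close> is at least a Ramsey number, which supplies \<open>ram\<close>.\<close>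

lemma card_indep_supersaturated:
  assumes ram: "\<And>Q. finite Q \<Longrightarrow> card Q = r \<Longrightarrow> Q \<subseteq> D \<Longrightarrow> \<exists>S\<subseteq>Q. card S = s \<and> indep S E"
    and "finite D" "s \<le> r" "r \<le> card D"
  shows "card D choose s \<le> (r choose s) * card {S. S \<subseteq> D \<and> card S = s \<and> indep S E}"
proof -
  let ?Q = "{Q. Q \<subseteq> D \<and> card Q = r}" and ?S = "{S. S \<subseteq> D \<and> card S = s \<and> indep S E}"
  have fin: "finite ?S" "finite ?Q"
    using \<open>finite D\<close> by auto
  have ext: "card {Q \<in> ?Q. S \<subseteq> Q} \<le> (card D - s) choose (r - s)" if "S \<in> ?S" for S
  proof -
    have "finite S" using that \<open>finite D\<close> finite_subset by auto
    have "inj_on (\<lambda>Q. Q - S) {Q \<in> ?Q. S \<subseteq> Q}"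
      by (rule inj_onI) blast
    moreover have "(\<lambda>Q. Q - S) ` {Q \<in> ?Q. S \<subseteq> Q} \<subseteq> {P. P \<subseteq> D - S \<and> card P = r - s}"
      using that \<open>finite S\<close> by (auto simp: card_Diff_subset)
    ultimately have "card {Q \<in> ?Q. S \<subseteq> Q} \<le> card {P. P \<subseteq> D - S \<and> card P = r - s}"
      using \<open>finite D\<close> by (intro card_inj_on_le) auto
    also have "\<dots> = card (D - S) choose (r - s)"
      using \<open>finite D\<close> by (simp add: n_subsets)
    also have "card (D - S) = card D - s"
      using that \<open>finite S\<close> by (simp add: card_Diff_subset)
    finally show ?thesis .
  qed
  have "card D choose r = (\<Sum>Q\<in>?Q. 1)"
    using \<open>finite D\<close> by (simp add: n_subsets)
  also have "\<dots> \<le> (\<Sum>Q\<in>?Q. card {S \<in> ?S. S \<subseteq> Q})"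
  proof (rule sum_mono)
    fix Q assume Q: "Q \<in> ?Q"
    then obtain S where "S \<subseteq> Q" "card S = s" "indep S E"
      using ram[of Q] \<open>finite D\<close> finite_subset by blast
    then have "{S \<in> ?S. S \<subseteq> Q} \<noteq> {}"
      using Q by auto
    then show "1 \<le> card {S \<in> ?S. S \<subseteq> Q}"
      using fin(1) by (metis (no_types, lifting) One_nat_def Suc_leI card_gt_0_iff finite_subset mem_Collect_eq subsetI)
  qed
  also have "\<dots> = (\<Sum>Q\<in>?Q. \<Sum>S\<in>{S \<in> ?S. S \<subseteq> Q}. 1)"
    by simp
  also have "\<dots> = (\<Sum>S\<in>?S. \<Sum>Q\<in>{Q \<in> ?Q. S \<subseteq> Q}. 1)"
    using fin by (intro sum.swap_restrict)
  also have "\<dots> = (\<Sum>S\<in>?S. card {Q \<in> ?Q. S \<subseteq> Q})"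
    by simp
  also have "\<dots> \<le> (\<Sum>S\<in>?S. (card D - s) choose (r - s))"
    using ext by (rule sum_mono)
  \<comment> \<open>The factor \<open>r choose s\<close> prepares for \<open>choose_mult\<close>,
    which rewrites the left side so that \<open>(card D - s) choose (r - s)\<close> stands on both
    sides. It is positive because \<open>r \<le> card D\<close>, and cancels.\<close>
  finally have "(card D choose r) * (r choose s) \<le> (r choose s) * card ?S * ((card D - s) choose (r - s))"
    by (simp add: mult.commute mult.assoc)
  then have "(card D choose s) * ((card D - s) choose (r - s)) \<le> (r choose s) * card ?S * ((card D - s) choose (r - s))"
    using choose_mult[of s r "card D"] assms by simp
  moreover have "0 < (card D - s) choose (r - s)"
    using assms by simp
  ultimately show ?thesis
    by simp
qed

section \<open>Recognising induced complete bipartite and complete split graphs\<close>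

text \<open>The flag \<open>c\<close> lets one argument serve both target graphs: \<open>X\<close>
  is a clique if \<open>c\<close> holds and independent otherwise. The condition on singletons is
  needed since \<open>sgraph_iso\<close> also compares \<open>{u, v}\<close> for
  \<open>u = v\<close>.\<close>

lemma sgraph_iso_induced_Un:
  fixes H :: "(nat + nat) sgraph"
  assumes Z: "\<And>u. {u} \<notin> Z"
    and fin: "finite X" "finite Y" and card: "card X = s" "card Y = t" and "X \<inter> Y = {}"
    and X: "\<And>x x'. x \<in> X \<Longrightarrow> x' \<in> X \<Longrightarrow> x \<noteq> x' \<Longrightarrow> {x, x'} \<in> Z \<longleftrightarrow> c"
    and Y: "indep Y Z" and XY: "\<And>x y. x \<in> X \<Longrightarrow> y \<in> Y \<Longrightarrow> {x, y} \<in> Z"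
    and H: "verts H = {..<s} <+> {..<t}"
      "\<And>i j. i < s \<Longrightarrow> j < s \<Longrightarrow> {Inl i, Inl j} \<in> edges H \<longleftrightarrow> c \<and> i \<noteq> j"
      "\<And>i j. i < t \<Longrightarrow> j < t \<Longrightarrow> {Inr i, Inr j} \<notin> edges H"
      "\<And>i j. i < s \<Longrightarrow> j < t \<Longrightarrow> {Inl i, Inr j} \<in> edges H"
  shows "sgraph_iso (induced (color_graph G Z) (X \<union> Y)) H"
proof -
  obtain f g where f: "bij_betw f X {..<s}" and g: "bij_betw g Y {..<t}"
    using fin card by (metis ex_bij_betw_finite_nat lessThan_atLeast0)
  define h where "h u = (if u \<in> X then Inl (f u) else Inr (g u))" for u
  have hX: "h x = Inl (f x)" if "x \<in> X" for x
    using that by (simp add: h_def)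
  have hY: "h y = Inr (g y)" if "y \<in> Y" for y
    using that \<open>X \<inter> Y = {}\<close> by (auto simp: h_def)
  have fs: "f x < s" if "x \<in> X" for x
    using f that by (auto simp: bij_betw_def)
  have gt: "g y < t" if "y \<in> Y" for y
    using g that by (auto simp: bij_betw_def)
  have fx: "f x = f x' \<longleftrightarrow> x = x'" if "x \<in> X" "x' \<in> X" for x x'
    using f that by (auto simp: bij_betw_def inj_on_def)
  have "h ` (X \<union> Y) = (Inl ` f ` X) \<union> (Inr ` g ` Y)"
    using hX hY by (simp add: image_Un image_image)
  also have "\<dots> = verts H"
    using f g by (simp add: H Plus_def bij_betw_def)
  finally have img: "h ` (X \<union> Y) = verts H" .
  \<comment> \<open>Injectivity of \<open>h\<close> is read off from surjectivity and equal finite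
    cardinalities.\<close>
  have "card (h ` (X \<union> Y)) = card (X \<union> Y)"
    unfolding img using H fin card \<open>X \<inter> Y = {}\<close> by (simp add: card_Plus card_Un_disjoint)
  then have "bij_betw h (X \<union> Y) (verts H)"
    using img fin by (simp add: bij_betw_def eq_card_imp_inj_on)
  moreover have "{u, v} \<in> Z \<longleftrightarrow> {h u, h v} \<in> edges H" if "u \<in> X \<union> Y" "v \<in> X \<union> Y" for u v
  proof -
    consider "u \<in> X" "v \<in> X" | "u \<in> Y" "v \<in> Y" | "u \<in> X" "v \<in> Y" | "u \<in> Y" "v \<in> X"
      using \<open>u \<in> X \<union> Y\<close> \<open>v \<in> X \<union> Y\<close> by blast
    then show ?thesis
    proof cases
      case 1
      then show ?thesis
        using X Z H(2)[of "f u" "f v"] by (cases "u = v") (simp_all add: hX fs fx)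
    next
      case 2
      then show ?thesis
        using Y Z H(3)[of "g u" "g v"] by (cases "u = v") (simp_all add: hY gt indep_def)
    next
      case 3
      then show ?thesis
        using XY by (simp add: hX hY H(4) fs gt)
    next
      case 4
      then show ?thesis
        using XY[of v u] H(4)[of "f v" "g u"] by (simp add: hX hY fs gt insert_commute)
    qed
  qed
  ultimately show ?thesis
    unfolding sgraph_iso_def by (auto simp: induced_def color_graph_def)
qed

lemma has_induced_mono_copyI:
  fixes H :: "(nat + nat) sgraph"
  assumes "Z = R \<or> Z = B" "X \<union> Y \<subseteq> verts G" "finite (verts G)" "verts H = {..<s} <+> {..<t}"
    and "card X = s" "card Y = t" "X \<inter> Y = {}"
    and "sgraph_iso (induced (color_graph G Z) (X \<union> Y)) H"
  shows "has_induced_mono_copy G R B H"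
proof -
  have "card (X \<union> Y) = card (verts H)"
    using assms finite_subset[OF _ \<open>finite (verts G)\<close>] by (simp add: card_Plus card_Un_disjoint)
  then show ?thesis
    using assms unfolding has_induced_mono_copy_def by blast
qed

lemma has_induced_mono_copy_complete_bipartite:
  assumes Z: "Z = R \<or> Z = B" "\<And>u. {u} \<notin> Z"
    and G: "X \<union> Y \<subseteq> verts G" "finite (verts G)"
    and XY: "card X = s" "card Y = t" "X \<inter> Y = {}"
    and edges: "indep X Z" "indep Y Z" "\<And>x y. x \<in> X \<Longrightarrow> y \<in> Y \<Longrightarrow> {x, y} \<in> Z"
  shows "has_induced_mono_copy G R B (complete_bipartite s t)"
proof (rule has_induced_mono_copyI[OF Z(1) G _ XY])
  have "finite X" "finite Y"
    using G finite_subset by auto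
  then show "sgraph_iso (induced (color_graph G Z) (X \<union> Y)) (complete_bipartite s t)"
    using Z(2) XY edges
    by (intro sgraph_iso_induced_Un[where c = False])
      (auto simp: complete_bipartite_def indep_def doubleton_eq_iff)
qed (simp add: complete_bipartite_def)

lemma has_induced_mono_copy_complete_split:
  assumes Z: "Z = R \<or> Z = B" "\<And>u. {u} \<notin> Z"
    and G: "X \<union> Y \<subseteq> verts G" "finite (verts G)"
    and XY: "card X = s" "card Y = t" "X \<inter> Y = {}"
    and edges: "clique X Z" "indep Y Z" "\<And>x y. x \<in> X \<Longrightarrow> y \<in> Y \<Longrightarrow> {x, y} \<in> Z"
  shows "has_induced_mono_copy G R B (complete_split s t)"
proof (rule has_induced_mono_copyI[OF Z(1) G _ XY])
  have "finite X" "finite Y"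
    using G finite_subset by auto
  then show "sgraph_iso (induced (color_graph G Z) (X \<union> Y)) (complete_split s t)"
    using Z(2) XY edges
    by (intro sgraph_iso_induced_Un[where c = True])
      (auto simp: complete_split_def clique_def doubleton_eq_iff)
qed (simp add: complete_split_def)

section \<open>The Kovari-Sos-Turan count over independent \<open>s\<close>-sets\<close>

text \<open>Counts pairs of a vertex \<open>v\<close> and an independent \<open>s\<close>-set inside
  its neighbourhood. Supersaturation bounds the \<open>s\<close>-th power of a degree at least
  \<open>r\<close> by a constant times the number of such sets for \<open>v\<close>; smaller degrees
  cost at most \<open>r ^ s\<close> each. Counted from the other side, each set occurs at most
  \<open>M\<close> times.\<close>

lemma sum_degree_power_le:
  fixes E :: "'a set set"
  assumes "finite V" "s \<ge> 1" "s \<le> r" "s \<le> card V"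
    and ram: "\<And>Q. Q \<subseteq> V \<Longrightarrow> card Q = r \<Longrightarrow> \<exists>S\<subseteq>Q. card S = s \<and> indep S E"
    and codeg: "\<And>S. S \<subseteq> V \<Longrightarrow> card S = s \<Longrightarrow> indep S E \<Longrightarrow>
      card {v \<in> V. \<forall>u\<in>S. {u, v} \<in> E} \<le> M"
  shows "(\<Sum>v\<in>V. card {u \<in> V. {u, v} \<in> E} ^ s) \<le> (r ^ s + s ^ s * (r choose s) * M) * card V ^ s"
proof -
  define N where "N v = {u \<in> V. {u, v} \<in> E}" for v
  define I where "I = {S. S \<subseteq> V \<and> card S = s \<and> indep S E}"
  have fin: "finite I" "finite (N v)" for v
    using \<open>finite V\<close> by (auto simp: I_def N_def)
  have deg: "card (N v) ^ s \<le> r ^ s + s ^ s * (r choose s) * card {S \<in> I. S \<subseteq> N v}" for v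
  proof (cases "r \<le> card (N v)")
    case True
    have "{S \<in> I. S \<subseteq> N v} = {S. S \<subseteq> N v \<and> card S = s \<and> indep S E}"
      by (auto simp: I_def N_def)
    moreover have "N v \<subseteq> V"
      by (auto simp: N_def)
    ultimately have sup: "card (N v) choose s \<le> (r choose s) * card {S \<in> I. S \<subseteq> N v}"
      using card_indep_supersaturated[of r "N v" s E] ram fin(2) \<open>s \<le> r\<close> True by (metis subset_trans)
    have "(real (card (N v)) / real s) ^ s \<le> real (card (N v) choose s)"
      using True \<open>s \<le> r\<close> by (intro binomial_ge_n_over_k_pow_k) simp
    then have "real (card (N v) ^ s) \<le> real (s ^ s * (card (N v) choose s))"
      using \<open>s \<ge> 1\<close> by (simp add: power_divide field_simps)
    then have "card (N v) ^ s \<le> s ^ s * (card (N v) choose s)"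
      by linarith
    also have "\<dots> \<le> s ^ s * ((r choose s) * card {S \<in> I. S \<subseteq> N v})"
      using sup by (rule mult_le_mono2)
    finally show ?thesis
      by (simp add: mult.assoc)
  next
    case False
    then show ?thesis
      by (simp add: power_mono trans_le_add1)
  qed
  have "(\<Sum>v\<in>V. card {S \<in> I. S \<subseteq> N v}) = (\<Sum>v\<in>V. \<Sum>S\<in>{S \<in> I. S \<subseteq> N v}. 1)"
    by simp
  also have "\<dots> = (\<Sum>S\<in>I. \<Sum>v\<in>{v \<in> V. S \<subseteq> N v}. 1)"
    using \<open>finite V\<close> fin by (intro sum.swap_restrict)
  also have "\<dots> \<le> (\<Sum>S\<in>I. M)"
  proof (rule sum_mono)
    fix S assume S: "S \<in> I"
    then have "{v \<in> V. S \<subseteq> N v} = {v \<in> V. \<forall>u\<in>S. {u, v} \<in> E}"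
      by (auto simp: I_def N_def)
    then show "(\<Sum>v\<in>{v \<in> V. S \<subseteq> N v}. 1) \<le> M"
      using S codeg by (simp add: I_def)
  qed
  also have "\<dots> \<le> M * card V ^ s"
  proof -
    have "card I \<le> card {S. S \<subseteq> V \<and> card S = s}"
      using \<open>finite V\<close> by (intro card_mono) (auto simp: I_def)
    also have "\<dots> \<le> card V ^ s"
      using \<open>finite V\<close> \<open>s \<le> card V\<close> by (simp add: n_subsets binomial_le_pow)
    finally show ?thesis
      by simp
  qed
  finally have count: "(\<Sum>v\<in>V. card {S \<in> I. S \<subseteq> N v}) \<le> M * card V ^ s" .
  have "(\<Sum>v\<in>V. card (N v) ^ s) \<le> (\<Sum>v\<in>V. r ^ s + s ^ s * (r choose s) * card {S \<in> I. S \<subseteq> N v})"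
    using deg by (rule sum_mono)
  also have "\<dots> = r ^ s * card V + s ^ s * (r choose s) * (\<Sum>v\<in>V. card {S \<in> I. S \<subseteq> N v})"
    by (simp add: sum.distrib sum_distrib_left mult.commute)
  \<comment> \<open>The small-degree term, linear in \<open>card V\<close>, is absorbed into
    \<open>card V ^ s\<close> since \<open>s \<ge> 1\<close>.\<close>
  also have "\<dots> \<le> r ^ s * card V ^ s + s ^ s * (r choose s) * (M * card V ^ s)"
    using count \<open>s \<ge> 1\<close> \<open>s \<le> card V\<close> by (intro add_mono mult_le_mono2 self_le_power) auto
  finally show ?thesis
    by (simp add: N_def algebra_simps)
qed

text \<open>Passes from the \<open>s\<close>-th moment of the degrees to their sum. Splitting the
  degrees at a threshold takes the place of the power mean inequality and costs only the
  \<open>1 +\<close> in the constant.\<close>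

lemma sum_le_powr_if_sum_power_le:
  fixes d :: "'a \<Rightarrow> nat"
  assumes "finite V" "V \<noteq> {}" "s \<ge> 1" and pow: "(\<Sum>v\<in>V. d v ^ s) \<le> K * card V ^ s"
  shows "real (\<Sum>v\<in>V. d v) \<le> (1 + real K) * real (card V) powr (2 - 1 / real s)"
proof -
  define n where "n = real (card V)"
  have "n > 0"
    using assms by (simp add: n_def card_gt_0_iff)
  \<comment> \<open>The threshold balancing the two terms of \<open>d \<le> l + d ^ s / l ^ (s - 1)\<close>.\<close>
  define l where "l = n powr (1 - 1 / real s)"
  have "l > 0"
    using \<open>n > 0\<close> by (simp add: l_def)
  have "real (d v) \<le> l + real (d v) ^ s / l ^ (s - 1)" for v
  proof (cases "real (d v) \<le> l")
    case True
    then show ?thesis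
      using \<open>l > 0\<close> by (simp add: add_increasing2)
  next
    case False
    then have "real (d v) * l ^ (s - 1) \<le> real (d v) * real (d v) ^ (s - 1)"
      using \<open>l > 0\<close> by (intro mult_left_mono power_mono) auto
    also have "\<dots> = real (d v) ^ s"
      using \<open>s \<ge> 1\<close> by (simp add: power_eq_if)
    finally have "real (d v) \<le> real (d v) ^ s / l ^ (s - 1)"
      using \<open>l > 0\<close> by (simp add: field_simps)
    then show ?thesis
      using \<open>l > 0\<close> by linarith
  qed
  then have "real (\<Sum>v\<in>V. d v) \<le> (\<Sum>v\<in>V. l + real (d v) ^ s / l ^ (s - 1))"
    by (simp add: sum_mono)
  also have "\<dots> = n * l + real (\<Sum>v\<in>V. d v ^ s) / l ^ (s - 1)"
    by (simp add: sum.distrib n_def sum_divide_distrib)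
  also have "\<dots> \<le> n * l + real (K * card V ^ s) / l ^ (s - 1)"
    using pow \<open>l > 0\<close> by (intro add_left_mono divide_right_mono) (simp_all only: of_nat_le_iff zero_le_power less_imp_le)
  also have "\<dots> = n * l + K * (n ^ s / l ^ (s - 1))"
    by (simp add: n_def)
  also have "n ^ s / l ^ (s - 1) = n powr (2 - 1 / real s)"
  proof -
    have "l ^ (s - 1) = n powr ((1 - 1 / real s) * (real s - 1))"
      using \<open>n > 0\<close> \<open>s \<ge> 1\<close> by (simp add: l_def flip: powr_realpow powr_powr)
    moreover have "n ^ s = n powr real s"
      using \<open>n > 0\<close> by (simp add: powr_realpow)
    moreover have "real s - (1 - 1 / real s) * (real s - 1) = 2 - 1 / real s"
      using \<open>s \<ge> 1\<close> by (simp add: field_simps)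
    ultimately show ?thesis
      by (simp flip: powr_diff)
  qed
  also have "n * l = n powr (2 - 1 / real s)"
    using \<open>n > 0\<close> powr_add[of n 1 "1 - 1 / real s"] by (simp add: l_def)
  finally show ?thesis
    by (simp add: n_def algebra_simps)
qed

text \<open>Each edge is counted at least once; the factor 2 of the handshake lemma would improve
  only the constant.\<close>

lemma card_edges_le_sum_degree:
  assumes "finite V" "\<And>e. e \<in> E \<Longrightarrow> \<exists>u\<in>V. \<exists>v\<in>V. e = {u, v}"
  shows "card E \<le> (\<Sum>v\<in>V. card {u \<in> V. {u, v} \<in> E})"
proof -
  have "E = (\<Union>v\<in>V. (\<lambda>u. {u, v}) ` {u \<in> V. {u, v} \<in> E})"
    using assms(2) by blast
  then have "card E \<le> card (\<Union>v\<in>V. (\<lambda>u. {u, v}) ` {u \<in> V. {u, v} \<in> E})"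
    by (intro eq_refl arg_cong[where f = card])
  also have "\<dots> \<le> (\<Sum>v\<in>V. card ((\<lambda>u. {u, v}) ` {u \<in> V. {u, v} \<in> E}))"
    using \<open>finite V\<close> by (rule card_UN_le)
  also have "\<dots> \<le> (\<Sum>v\<in>V. card {u \<in> V. {u, v} \<in> E})"
    using \<open>finite V\<close> by (intro sum_mono card_image_le) simp
  finally show ?thesis .
qed

text \<open>The clique-free colour alone, viewed as a graph \<open>E\<close>; cliques of the other
  colour are its independent sets. The constant is obtained before \<open>V\<close> and
  \<open>E\<close>, hence depends only on \<open>s\<close>, \<open>m\<close> and
  \<open>T\<close>.\<close>

lemma clique_free_induced_complete_bipartite:
  fixes s m T :: nat
  assumes "s \<ge> 1"
  obtains C :: real where
    "\<And>(V :: 'a set) E. \<lbrakk>finite V; s \<le> card V; \<And>e. e \<in> E \<Longrightarrow> \<exists>u\<in>V. \<exists>v\<in>V. e = {u, v};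
      \<And>u. {u} \<notin> E; \<And>Q. Q \<subseteq> V \<Longrightarrow> card Q = T \<Longrightarrow> \<not> clique Q E;
      C * real (card V) powr (2 - 1 / real s) \<le> card E\<rbrakk>
      \<Longrightarrow> \<exists>X Y. X \<union> Y \<subseteq> V \<and> X \<inter> Y = {} \<and> card X = s \<and> card Y = m \<and> indep X E \<and> indep Y E \<and>
            (\<forall>x\<in>X. \<forall>y\<in>Y. {x, y} \<in> E)"
proof -
  obtain r0 where r0: "\<And>(V :: 'a set) E. finite V \<Longrightarrow> r0 \<le> card V \<Longrightarrow>
      \<exists>Q\<subseteq>V. card Q = T \<and> clique Q E \<or> card Q = s \<and> indep Q E"
    using ramsey2[of T s] by blast
  obtain M where M: "\<And>(V :: 'a set) E. finite V \<Longrightarrow> M \<le> card V \<Longrightarrow>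
      \<exists>Q\<subseteq>V. card Q = T \<and> clique Q E \<or> card Q = m \<and> indep Q E"
    using ramsey2[of T m] by blast
  \<comment> \<open>The maximum secures \<open>s \<le> r\<close>, which supersaturation
    requires.\<close>
  define r where "r = max r0 s"
  define K where "K = r ^ s + s ^ s * (r choose s) * M"
  show thesis
  \<comment> \<open>The degree count yields the coefficient \<open>1 + K\<close>; one more makes the
    contradiction strict, as the power of \<open>card V\<close> is positive.\<close>
  proof (rule that[of "2 + real K"])
    fix V :: "'a set" and E
    assume V: "finite V" "s \<le> card V" and E: "\<And>e. e \<in> E \<Longrightarrow> \<exists>u\<in>V. \<exists>v\<in>V. e = {u, v}" "\<And>u. {u} \<notin> E"
      and free: "\<And>Q. Q \<subseteq> V \<Longrightarrow> card Q = T \<Longrightarrow> \<not> clique Q E"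
      and large: "(2 + real K) * real (card V) powr (2 - 1 / real s) \<le> card E"
    have "card V > 0"
      using V \<open>s \<ge> 1\<close> by linarith
    have "\<exists>X\<subseteq>V. card X = s \<and> indep X E \<and> M < card {v \<in> V. \<forall>u\<in>X. {u, v} \<in> E}"
    proof (rule ccontr)
      assume contra: "\<not> ?thesis"
      have "\<exists>S\<subseteq>Q. card S = s \<and> indep S E" if "Q \<subseteq> V" "card Q = r" for Q
        using r0[of Q E] free that V(1) finite_subset[of Q V] by (metis max.cobounded1 r_def subset_trans)
      then have "(\<Sum>v\<in>V. card {u \<in> V. {u, v} \<in> E} ^ s) \<le> K * card V ^ s"
        unfolding K_def using V \<open>s \<ge> 1\<close> contra
        by (intro sum_degree_power_le) (auto simp: r_def not_less)
      then have "real (\<Sum>v\<in>V. card {u \<in> V. {u, v} \<in> E}) \<le> (1 + real K) * real (card V) powr (2 - 1 / real s)"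
        using V \<open>s \<ge> 1\<close> \<open>card V > 0\<close> by (intro sum_le_powr_if_sum_power_le) auto
      moreover have "card E \<le> (\<Sum>v\<in>V. card {u \<in> V. {u, v} \<in> E})"
        using V(1) E(1) by (rule card_edges_le_sum_degree)
      ultimately have "(2 + real K) * real (card V) powr (2 - 1 / real s)
          \<le> (1 + real K) * real (card V) powr (2 - 1 / real s)"
        using large by linarith
      then show False
        using \<open>card V > 0\<close> by (simp add: algebra_simps not_le)
    qed
    then obtain X where X: "X \<subseteq> V" "card X = s" "indep X E" "M < card {v \<in> V. \<forall>u\<in>X. {u, v} \<in> E}"
      by blast
    let ?N = "{v \<in> V. \<forall>u\<in>X. {u, v} \<in> E}"
    obtain Y where Y: "Y \<subseteq> ?N" "card Y = m" "indep Y E"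
      using M[of ?N E] X V free by (auto simp: subset_iff)
    \<comment> \<open>A vertex in both sets would be its own neighbour, putting a singleton into
      \<open>E\<close>.\<close>
    have "X \<inter> Y = {}"
      using Y E(2) by (metis (no_types, lifting) disjoint_iff insert_absorb2 mem_Collect_eq subsetD)
    then show "\<exists>X Y. X \<union> Y \<subseteq> V \<and> X \<inter> Y = {} \<and> card X = s \<and> card Y = m \<and> indep X E \<and> indep Y E \<and>
            (\<forall>x\<in>X. \<forall>y\<in>Y. {x, y} \<in> E)"
      using X Y by (intro exI[of _ X] exI[of _ Y]) auto
  qed
qed

section \<open>Two-colourings of the complete graph and the final case split\<close>

lemma two_edge_coloring_complete_graph:
  assumes "two_edge_coloring (complete_graph n) R B"
  shows "e \<in> R \<union> B \<Longrightarrow> \<exists>u\<in>{..<n}. \<exists>v\<in>{..<n}. e = {u, v}" "{u} \<notin> R \<union> B"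
    and "u < n \<Longrightarrow> v < n \<Longrightarrow> u \<noteq> v \<Longrightarrow> {u, v} \<in> R \<longleftrightarrow> {u, v} \<notin> B"
proof -
  have RB: "R \<union> B = {{i, j} | i j. i < n \<and> j < n \<and> i \<noteq> j}" "R \<inter> B = {}"
    using assms by (auto simp: two_edge_coloring_def complete_graph_def)
  show "e \<in> R \<union> B \<Longrightarrow> \<exists>u\<in>{..<n}. \<exists>v\<in>{..<n}. e = {u, v}"
    unfolding RB(1) by auto
  show "{u} \<notin> R \<union> B"
    unfolding RB(1) by auto
  assume "u < n" "v < n" "u \<noteq> v"
  then have "{u, v} \<in> R \<union> B"
    unfolding RB(1) by auto
  then show "{u, v} \<in> R \<longleftrightarrow> {u, v} \<notin> B"
    using RB(2) by auto
qed

text \<open>The \<open>+ 1\<close> pays for the vertex that \<open>K\<close> and \<open>L\<close>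
  may share. Whichever colour the edges between \<open>X\<close> and \<open>Y\<close> have, the set
  that is a clique in that colour becomes the clique side, and the other set, a clique of the
  opposite colour, is independent.\<close>

lemma complete_split_if_both_cliques:
  assumes col: "two_edge_coloring (complete_graph n) R B"
    and K: "K \<subseteq> {..<n}" "clique K R" "2 * t + 1 \<le> card K"
    and L: "L \<subseteq> {..<n}" "clique L B" "t * 2 ^ (2 * t) \<le> card L"
  shows "has_induced_mono_copy (complete_graph n) R B (complete_split t t)"
proof -
  note RB = two_edge_coloring_complete_graph[OF col]
  have fin: "finite K" "finite L"
    using K L finite_subset by auto
  \<comment> \<open>Two distinct common vertices would span an edge that is both red and
    blue.\<close>
  have "u = v" if "u \<in> K \<inter> L" "v \<in> K \<inter> L" for u v
    using that K L RB(3)[of u v] by (auto simp: clique_def subset_iff)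
  then have "card (K \<inter> L) \<le> 1"
    by (simp add: card_le_Suc0_iff_eq fin)
  then have "2 * t \<le> card (K - L)"
    using K fin by (simp add: card_Diff_subset_Int)
  then obtain X Y where XY: "X \<subseteq> K - L" "Y \<subseteq> L" "card X = t" "card Y = t"
    "(\<forall>x\<in>X. \<forall>y\<in>Y. {x, y} \<in> R) \<or> (\<forall>x\<in>X. \<forall>y\<in>Y. {x, y} \<notin> R)"
    using bipartite_mono_pair[of "K - L" t L "\<lambda>x y. {x, y} \<in> R"] fin L by blast
  have sub: "X \<union> Y \<subseteq> {..<n}" and disj: "X \<inter> Y = {}"
    using XY K L by auto
  have lt: "u < n" if "u \<in> X \<union> Y" for u using sub that by auto
  have XR: "clique X R" and YB: "clique Y B"
    using XY K L by (auto simp: clique_def subset_iff)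
  have XB: "indep X B" and YR: "indep Y R"
    using XR YB RB(3) lt by (auto simp: clique_def indep_def)
  have verts: "verts (complete_graph n) = {..<n}"
    by (simp add: complete_graph_def)
  show ?thesis
    using XY(5)
  proof
    assume "\<forall>x\<in>X. \<forall>y\<in>Y. {x, y} \<in> R"
    then show ?thesis
      using XY XR YR sub disj RB(2)
      by (intro has_induced_mono_copy_complete_split[of R R B X Y]) (auto simp: verts)
  next
    assume "\<forall>x\<in>X. \<forall>y\<in>Y. {x, y} \<notin> R"
    then have "{y, x} \<in> B" if "y \<in> Y" "x \<in> X" for x y
      using that RB(3)[of x y] lt disj by (auto simp: insert_commute)
    then show ?thesis
      using XY XB YB sub disj RB(2)
      by (intro has_induced_mono_copy_complete_split[of B R B Y X]) (auto simp: verts)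
  qed
qed

theorem theorem2p2:
  fixes s t :: nat
  assumes "s \<ge> 1" and "t \<ge> max 2 s"
  shows "\<exists>C::real. \<exists>n0::nat. \<forall>n\<ge>n0. \<forall>R B.
           two_edge_coloring (complete_graph n) R B \<longrightarrow>
           min (real (card R)) (real (card B)) \<ge> C * real n powr (2 - 1 / real s) \<longrightarrow>
             has_induced_mono_member (complete_graph n) R B
               {complete_bipartite s (bipartite_ramsey t), complete_split t t} \<and>
             has_induced_mono_member (complete_graph n) R B (unavoidable_family s t)"
proof -
  \<comment> \<open>The sum of the two size bounds in \<open>complete_split_if_both_cliques\<close>,
    so a \<open>T\<close>-clique is large enough in either colour.\<close>
  define T where "T = 2 * t + 1 + t * 2 ^ (2 * t)"
  \<comment> \<open>With this maximum the existence of the bipartite Ramsey number (nonemptiness of the set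
    under \<open>LEAST\<close>) and the bound \<open>t \<le> bipartite_ramsey t\<close> are never used.\<close>
  define m where "m = max t (bipartite_ramsey t)"
  obtain C :: real where C: "\<And>(V :: nat set) E. \<lbrakk>finite V; s \<le> card V;
      \<And>e. e \<in> E \<Longrightarrow> \<exists>u\<in>V. \<exists>v\<in>V. e = {u, v};
      \<And>u. {u} \<notin> E; \<And>Q. Q \<subseteq> V \<Longrightarrow> card Q = T \<Longrightarrow> \<not> clique Q E;
      C * real (card V) powr (2 - 1 / real s) \<le> card E\<rbrakk>
      \<Longrightarrow> \<exists>X Y. X \<union> Y \<subseteq> V \<and> X \<inter> Y = {} \<and> card X = s \<and> card Y = m \<and> indep X E \<and> indep Y E \<and>
            (\<forall>x\<in>X. \<forall>y\<in>Y. {x, y} \<in> E)"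
    by (rule clique_free_induced_complete_bipartite[OF \<open>s \<ge> 1\<close>, of T m, where ?'a = nat]) (erule that)
  show ?thesis
  \<comment> \<open>The threshold \<open>s\<close> for \<open>n\<close> only ensures that
    \<open>s\<close>-subsets of the vertex set exist.\<close>
  proof (intro exI[of _ C] exI[of _ s] allI impI)
    fix n :: nat and R B
    assume "s \<le> n" and col: "two_edge_coloring (complete_graph n) R B"
      and large: "C * real n powr (2 - 1 / real s) \<le> min (real (card R)) (real (card B))"
    note RB = two_edge_coloring_complete_graph[OF col]
    \<comment> \<open>A side of size \<open>m\<close> may be shrunk to any \<open>k \<le> m\<close>,
      as independence is hereditary. Thus \<open>k = t\<close> and
      \<open>k = bipartite_ramsey t\<close> are handled together, which yields both
      conclusions.\<close>
    have bip: "has_induced_mono_copy (complete_graph n) R B (complete_bipartite s k)"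
      if Z: "Z = R \<or> Z = B" and "k \<le> m"
        and free: "\<And>Q. Q \<subseteq> {..<n} \<Longrightarrow> card Q = T \<Longrightarrow> \<not> clique Q Z" for Z k
    proof -
      have loop: "{u} \<notin> Z" for u
        using Z RB(2) by auto
      have "\<exists>X Y. X \<union> Y \<subseteq> {..<n} \<and> X \<inter> Y = {} \<and> card X = s \<and> card Y = m \<and> indep X Z \<and> indep Y Z \<and>
            (\<forall>x\<in>X. \<forall>y\<in>Y. {x, y} \<in> Z)"
      proof (rule C)
        show "\<exists>u\<in>{..<n}. \<exists>v\<in>{..<n}. e = {u, v}" if "e \<in> Z" for e
          using that Z RB(1) by blast
      qed (use loop free large \<open>s \<le> n\<close> Z in auto)
      then obtain X Y where XY: "X \<union> Y \<subseteq> {..<n}" "X \<inter> Y = {}" "card X = s" "card Y = m"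
        "indep X Z" "indep Y Z" "\<forall>x\<in>X. \<forall>y\<in>Y. {x, y} \<in> Z"
        by blast
      obtain Y' where Y': "Y' \<subseteq> Y" "card Y' = k"
        using XY(4) \<open>k \<le> m\<close> obtain_subset_with_card_n by metis
      have "indep Y' Z"
        using XY(6) \<open>Y' \<subseteq> Y\<close> by (auto simp: indep_def subset_iff)
      then show ?thesis
        using XY Y' Z loop
        by (intro has_induced_mono_copy_complete_bipartite[of Z R B X Y'])
          (auto simp: complete_graph_def)
    qed
    have "has_induced_mono_copy (complete_graph n) R B (complete_split t t) \<or>
      (\<forall>k\<le>m. has_induced_mono_copy (complete_graph n) R B (complete_bipartite s k))"
    proof (cases "(\<exists>Q\<subseteq>{..<n}. card Q = T \<and> clique Q R) \<and> (\<exists>Q\<subseteq>{..<n}. card Q = T \<and> clique Q B)")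
      case True
      then show ?thesis
        using complete_split_if_both_cliques[OF col] by (auto simp: T_def)
    next
      case False
      then show ?thesis
        \<comment> \<open>Either colour can play the clique-free one, because the hypothesis bounds
          the smaller of the two edge counts from below.\<close>
        using bip by blast
    qed
    then show "has_induced_mono_member (complete_graph n) R B
          {complete_bipartite s (bipartite_ramsey t), complete_split t t} \<and>
        has_induced_mono_member (complete_graph n) R B (unavoidable_family s t)"
      by (auto simp: has_induced_mono_member_def unavoidable_family_def m_def)
  qed
qed

end
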